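(* For every graph $G$ and every 2-switch $\tau$ on $G$, $|\gamma(\tau(G))-\gamma(G)|\le 1$, where $\gamma$ denotes the domination number.
   Context: Graphs are finite and simple. A 2-switch on $G$ is specified by four distinct vertices $a,b,c,d$ with $ab,cd\in E(G)$ and $ac,bd\notin E(G)$; it produces $\tau(G)=G-ab-cd+ac+bd$. $\gamma(G)$ is the minimum size of a set $D\subseteq V(G)$ such that every vertex not in $D$ is adjacent to some vertex of $D$. *)

theory Defs
  imports "Graph_Theory.Pair_Digraph"
begin

text \<open>A finite simple graph is a \<^locale>\<open>pair_graph\<close>: a finite vertex set together with a
  symmetric, irreflexive set of arcs, so the edge \<open>uv\<close> is the pair of arcs
  \<open>(u, v)\<close> and \<open>(v, u)\<close>.\<close>

definition edge_arcs :: "'a \<Rightarrow> 'a \<Rightarrow> ('a \<times> 'a) set" where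
  "edge_arcs u v = {(u, v), (v, u)}"

definition is_two_switch :: "'a pair_pre_digraph \<Rightarrow> 'a \<Rightarrow> 'a \<Rightarrow> 'a \<Rightarrow> 'a \<Rightarrow> bool" where
  "is_two_switch G a b c d \<longleftrightarrow>
     {a, b, c, d} \<subseteq> pverts G \<and> distinct [a, b, c, d] \<and>
     (a, b) \<in> parcs G \<and> (c, d) \<in> parcs G \<and>
     (a, c) \<notin> parcs G \<and> (b, d) \<notin> parcs G"

definition two_switch :: "'a pair_pre_digraph \<Rightarrow> 'a \<Rightarrow> 'a \<Rightarrow> 'a \<Rightarrow> 'a \<Rightarrow> 'a pair_pre_digraph" where
  "two_switch G a b c d =
     \<lparr> pverts = pverts G,
       parcs = (parcs G - (edge_arcs a b \<union> edge_arcs c d)) \<union> (edge_arcs a c \<union> edge_arcs b d) \<rparr>"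

definition dominating :: "'a pair_pre_digraph \<Rightarrow> 'a set \<Rightarrow> bool" where
  "dominating G D \<longleftrightarrow>
     D \<subseteq> pverts G \<and> (\<forall>v \<in> pverts G - D. \<exists>u \<in> D. (u, v) \<in> parcs G)"

definition domination_number :: "'a pair_pre_digraph \<Rightarrow> nat" where
  "domination_number G = Min (card ` {D. dominating G D})"

lemma pair_graph_two_switch:
  assumes "pair_graph G" and "is_two_switch G a b c d"
  shows "pair_graph (two_switch G a b c d)"
proof -
  interpret pair_graph G by fact
  have sym: "sym (parcs G)" using pair_sym_arcs by (simp add: symmetric_def)
  show ?thesis
  proof
    show "fst e \<in> pverts (two_switch G a b c d)" if "e \<in> parcs (two_switch G a b c d)" for e
      using that assms(2) in_arcsD1
      by (auto simp: two_switch_def edge_arcs_def is_two_switch_def)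
    show "snd e \<in> pverts (two_switch G a b c d)" if "e \<in> parcs (two_switch G a b c d)" for e
      using that assms(2) in_arcsD2
      by (auto simp: two_switch_def edge_arcs_def is_two_switch_def)
    show "finite (pverts (two_switch G a b c d))" by (simp add: two_switch_def)
    show "finite (parcs (two_switch G a b c d))" by (simp add: two_switch_def edge_arcs_def)
    show "fst e \<noteq> snd e" if "e \<in> parcs (two_switch G a b c d)" for e
      using that assms(2) no_loops
      by (auto simp: two_switch_def edge_arcs_def is_two_switch_def)
    show "symmetric (with_proj (two_switch G a b c d))"
      using sym
      by (auto simp: symmetric_def two_switch_def edge_arcs_def sym_def)
  qed
qed

end

theory Submission
  imports Defs
begin

text \<open>Deleting \<open>ab\<close> and \<open>cd\<close> can leave at most one endpoint of each edge undominated by a given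
  dominating set. If both edges cause such a loss, then either the two lost vertices are joined by
  a new edge, so adding one of them repairs both, or each of them is joined by a new edge to the
  old dominator of the other and nothing is lost. Hence the domination number grows by at most
  one; the other inequality follows because a 2-switch is undone by a 2-switch.\<close>

lemma dominating_two_switch_insert:
  assumes "is_two_switch G a b c d" and "dominating G D"
  obtains x where "x \<in> pverts G" and "dominating (two_switch G a b c d) (insert x D)"
proof -
  \<comment> \<open>If \<open>D\<close> meets {\<open>a\<close>, \<open>b\<close>}, this puts both
    into \<open>insert x D\<close>; otherwise losing \<open>ab\<close> is harmless and the same is
    done for {\<open>c\<close>, \<open>d\<close>}. When \<open>D\<close> misses all four, the value
    \<open>d\<close> is arbitrary.\<close>
  define x where "x = (if b \<in> D then a else if a \<in> D then b else if d \<in> D then c else d)"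
  have verts: "{a, b, c, d} \<subseteq> pverts G"
    using assms(1) by (simp add: is_two_switch_def)
  have D: "D \<subseteq> pverts G" and dom: "\<And>v. v \<in> pverts G - D \<Longrightarrow> \<exists>u\<in>D. (u, v) \<in> parcs G"
    using assms(2) by (auto simp: dominating_def)
  have x: "x \<in> pverts G"
    using verts by (simp add: x_def)
  let ?E = "parcs (two_switch G a b c d)"
  have new: "{(a, c), (c, a), (b, d), (d, b)} \<subseteq> ?E"
    by (auto simp: two_switch_def edge_arcs_def)
  have "\<exists>u\<in>insert x D. (u, v) \<in> ?E" if v: "v \<in> pverts G - insert x D" for v
  proof -
    obtain u where u: "u \<in> D" "(u, v) \<in> parcs G"
      using dom v by blast
    show ?thesis
    proof (cases "(u, v) \<in> ?E")
      case True
      then show ?thesis using u by blast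
    next
      case False
      then have "(u, v) \<in> {(a, b), (b, a), (c, d), (d, c)}"
        using u by (auto simp: two_switch_def edge_arcs_def)
      \<comment> \<open>Since \<open>v\<close> lies outside \<open>insert x D\<close>, the choice of
        \<open>x\<close> leaves only the case where \<open>v\<close> is \<open>c\<close> or
        \<open>d\<close> and both \<open>a\<close> and \<open>b\<close> are in
        \<open>insert x D\<close>; then \<open>ac\<close> or \<open>bd\<close> dominates
        \<open>v\<close>.\<close>
      then show ?thesis
        using u v new by (auto simp: x_def split: if_splits)
    qed
  qed
  then have "dominating (two_switch G a b c d) (insert x D)"
    using D x by (simp add: dominating_def two_switch_def)
  with x show thesis by (rule that)
qed

lemma finite_dominating:
  assumes "finite (pverts G)"
  shows "finite {D. dominating G D}"
  by (rule finite_subset[of _ "Pow (pverts G)"]) (use assms in \<open>auto simp: dominating_def\<close>)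

lemma domination_number_le:
  assumes "finite (pverts G)" and "dominating G D"
  shows "domination_number G \<le> card D"
  using finite_dominating[OF assms(1)] assms(2) by (simp add: domination_number_def)

lemma domination_number_attained:
  assumes "finite (pverts G)"
  obtains D where "dominating G D" and "card D = domination_number G"
proof -
  \<comment> \<open>This makes the set under \<open>Min\<close> nonempty, so the minimum is
    attained.\<close>
  have "dominating G (pverts G)"
    by (simp add: dominating_def)
  then have "domination_number G \<in> card ` {D. dominating G D}"
    unfolding domination_number_def using finite_dominating[OF assms] by (intro Min_in) auto
  then show thesis using that by auto
qed

lemma domination_number_two_switch_le:
  assumes "finite (pverts G)" and "is_two_switch G a b c d"
  shows "domination_number (two_switch G a b c d) \<le> domination_number G + 1"
proof -
  obtain D where D: "dominating G D" "card D = domination_number G"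
    using domination_number_attained[OF assms(1)] .
  obtain x where "dominating (two_switch G a b c d) (insert x D)"
    using dominating_two_switch_insert[OF assms(2) D(1)] .
  then have "domination_number (two_switch G a b c d) \<le> card (insert x D)"
    using assms(1) by (intro domination_number_le) (simp_all add: two_switch_def)
  also have "\<dots> \<le> card D + 1"
    by (simp add: card_insert_le_m1 card_insert_if)
  finally show ?thesis by (simp add: D(2))
qed

text \<open>Exchanging the roles of \<open>b\<close> and \<open>c\<close> swaps the removed pair of
  edges with the added pair; distinctness keeps the two pairs disjoint.\<close>

lemma is_two_switch_reverse:
  assumes "is_two_switch G a b c d"
  shows "is_two_switch (two_switch G a b c d) a c b d"
  using assms by (auto simp: is_two_switch_def two_switch_def edge_arcs_def)

lemma two_switch_reverse:
  assumes "sym (parcs G)" and "is_two_switch G a b c d"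
  shows "two_switch (two_switch G a b c d) a c b d = G"
proof -
  \<comment> \<open>\<open>is_two_switch\<close> constrains one orientation of each edge; symmetry
    gives the other. Hence the first switch removes only arcs that were present and adds only absent
    ones, so the second restores \<open>parcs G\<close> exactly.\<close>
  have "edge_arcs a b \<union> edge_arcs c d \<subseteq> parcs G"
    and "(edge_arcs a c \<union> edge_arcs b d) \<inter> parcs G = {}"
    using assms by (auto simp: is_two_switch_def edge_arcs_def dest: symD)
  then have "parcs (two_switch (two_switch G a b c d) a c b d) = parcs G"
    by (auto simp: two_switch_def)
  then show ?thesis
    by (cases G) (simp add: two_switch_def)
qed

theorem mainTheorem13:
  fixes G :: "'a pair_pre_digraph" and a b c d :: 'a
  assumes "pair_graph G"
    and "is_two_switch G a b c d"
  shows "\<bar>int (domination_number (two_switch G a b c d)) - int (domination_number G)\<bar> \<le> 1"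
proof -
  interpret pair_graph G by fact
  let ?H = "two_switch G a b c d"
  have sym: "sym (parcs G)"
    using pair_sym_arcs by (simp add: symmetric_def)
  have "finite (pverts ?H)"
    by (simp add: two_switch_def)
  then have "domination_number (two_switch ?H a c b d) \<le> domination_number ?H + 1"
    using is_two_switch_reverse[OF assms(2)] by (rule domination_number_two_switch_le)
  then have "domination_number G \<le> domination_number ?H + 1"
    by (simp add: two_switch_reverse[OF sym assms(2)])
  moreover have "domination_number ?H \<le> domination_number G + 1"
    using assms(2) by (intro domination_number_two_switch_le) simp_all
  ultimately show ?thesis by linarith
qed

end
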